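(* Let $d\ge 1$ and let $X$ and $X_{\mathbf n}$, $\mathbf n\in\mathbb Z_+^d$, be real-valued random variables on a probability space $(\Omega,\mathcal F,P)$ (no assumption is made on their dependence). Assume there is a constant $M>0$ such that $$\frac{1}{|\mathbf n|}\sum_{\mathbf k\preceq \mathbf n}P(|X_{\mathbf k}|>x)\le M\,P(|X|>x)\qquad\text{for all } x\ge 0 \text{ and all } \mathbf n\in\mathbb Z_+^d .$$ Let $1<p<2$ and $1\le r\le p$. If $E\big[|X|^p(\log^+|X|)^{d-1}\big]<\infty$, then for every $\epsilon>0$ and for almost all $t\in\mathbb T^d$ (with respect to Lebesgue measure), $$\sum_{\mathbf n\in\mathbb Z_+^d}|\mathbf n|^{p/r-2}\,P\big(|S_{\mathbf n}(t)|>\epsilon|\mathbf n|^{1/r}\big)<\infty .$$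
   Context: $\mathbb Z_+^d$ is the set of $d$-dimensional lattice points with positive integer coordinates. For $\mathbf k,\mathbf n\in\mathbb Z_+^d$, $\mathbf k\preceq\mathbf n$ means $k_i\le n_i$ for all $1\le i\le d$, and $|\mathbf n|=n_1n_2\cdots n_d$. $\mathbb T=[-\pi,\pi)$. For $t=(t_1,\dots,t_d)\in\mathbb T^d$, $\mathbf k\cdot t=k_1t_1+\cdots+k_dt_d$, and the discrete Fourier transform is $S_{\mathbf n}(t)=\sum_{\mathbf k\preceq\mathbf n}e^{i\mathbf k\cdot t}X_{\mathbf k}$. The notation $\log^+x$ means $\max\{1,\log x\}$ (equal to $1$ at $x=0$). *)

theory Defs
  imports "HOL-Probability.Probability"
begin

text \<open>
  The dimension is the cardinality of the finite index type \<open>'d\<close>. On \<^typ>\<open>nat^'d\<close> the library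
  order \<open>\<le>\<close> is the componentwise one.
\<close>

definition pos_lattice :: "(nat^'d) set" where
  "pos_lattice = {n. \<forall>i. 0 < n $ i}"

definition lattice_box :: "nat^'d \<Rightarrow> (nat^'d) set" where
  "lattice_box n = {k \<in> pos_lattice. k \<le> n}"

definition lattice_vol :: "nat^'d \<Rightarrow> real" where
  "lattice_vol n = (\<Prod>i\<in>UNIV. real (n $ i))"

definition torus :: "(real^'d) set" where
  "torus = {t. \<forall>i. t $ i \<in> {-pi..<pi}}"

definition freq_dot :: "nat^'d \<Rightarrow> real^'d \<Rightarrow> real" where
  "freq_dot k t = (\<Sum>i\<in>UNIV. real (k $ i) * t $ i)"

definition dft :: "(nat^'d \<Rightarrow> 'a \<Rightarrow> real) \<Rightarrow> nat^'d \<Rightarrow> real^'d \<Rightarrow> 'a \<Rightarrow> complex" where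
  "dft Y n t \<omega> =
     (\<Sum>k\<in>lattice_box n. exp (\<i> * complex_of_real (freq_dot k t)) * complex_of_real (Y k \<omega>))"

text \<open>The cut-off is at 1 rather than 0. It is only applied to arguments \<open>x \<ge> 0\<close>, and the
  library's \<open>ln 0 = 0\<close> gives the intended value 1 at \<open>x = 0\<close>.\<close>

definition log_plus :: "real \<Rightarrow> real" where
  "log_plus x = max 1 (ln x)"

end

theory Submission
  imports Defs
begin

text \<open>
  Truncate \<open>Y k\<close> at height \<open>a = |n|\<^sup>1\<^sup>/\<^sup>r\<close>. A union bound for the large values and
  Chebyshev's inequality for the truncated sum bound \<open>P(|S_n(t)| > \<epsilon> a)\<close> by a function of \<open>t\<close>
  whose torus integral is, by orthogonality of the characters, at most a constant times
  \<open>a\<^sup>-\<^sup>2 \<Sum>\<^sub>k E min(Y\<^sub>k\<^sup>2, a\<^sup>2)\<close>. No maximal inequality is needed, because each \<open>n\<close> contributes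
  separately. The layer-cake formula and the domination hypothesis replace the last sum by
  \<open>M |n| E min(X\<^sup>2, a\<^sup>2)\<close>. It then suffices that
  \<open>\<Sum>\<^sub>n |n|\<^sup>p\<^sup>/\<^sup>r\<^sup>-\<^sup>1\<^sup>-\<^sup>2\<^sup>/\<^sup>r min(x\<^sup>2, |n|\<^sup>2\<^sup>/\<^sup>r) \<le> C |x|\<^sup>p (log\<^sup>+ |x|)\<^sup>d\<^sup>-\<^sup>1\<close>, which follows by counting the
  lattice points under the hyperboloid \<open>|n| \<le> y\<close>. The series of probabilities is thus dominated
  by a function that is integrable over the torus.
\<close>

subsection \<open>Lattice points under a hyperboloid\<close>

lemma harm_le_one_plus_ln: "n \<ge> 1 \<Longrightarrow> (\<Sum>m=1..n. 1 / real m) \<le> 1 + ln (real n)"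
proof (induction n rule: nat_induct_at_least)
  case (Suc n)
  \<comment> \<open>The inequality ln u <= u - 1 at u = n / (n + 1) bounds the new harmonic term by
    the increment of the logarithm.\<close>
  have "ln (real n / real (Suc n)) \<le> real n / real (Suc n) - 1"
    using Suc by (intro ln_le_minus_one) auto
  then have "1 / real (Suc n) \<le> ln (real (Suc n)) - ln (real n)"
    using Suc by (simp add: ln_div field_simps)
  then show ?case using Suc by simp
qed simp

text \<open>The number of positive integer points under the hyperboloid is bounded by induction on the
  number of coordinates, splitting off one coordinate and summing the harmonic series.\<close>

lemma card_hyperboloid_PiE:
  fixes x :: real
  assumes "finite I" "I \<noteq> {}" "x \<ge> 1"
  defines "A \<equiv> \<lambda>I x. {f \<in> I \<rightarrow>\<^sub>E {1::nat..}. real (\<Prod>i\<in>I. f i) \<le> x}"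
  shows "finite (A I x) \<and> real (card (A I x)) \<le> x * (1 + ln x) ^ (card I - 1)"
  using assms(1-3)
proof (induction I arbitrary: x rule: finite_ne_induct)
  case (singleton j)
  \<comment> \<open>Extensional functions take the value \<open>undefined\<close> off
    \<open>{j}\<close>, so each one is determined by its value at \<open>j\<close>, a positive
    integer at most x.\<close>
  have sub: "A {j} x \<subseteq> (\<lambda>m. (\<lambda>i. if i = j then m else undefined)) ` {1..nat \<lfloor>x\<rfloor>}"
  proof
    fix f assume f: "f \<in> A {j} x"
    then have "f = (\<lambda>i. if i = j then f j else undefined)" "f j \<in> {1..nat \<lfloor>x\<rfloor>}"
      by (auto simp: A_def PiE_def extensional_def le_nat_floor)
    then show "f \<in> (\<lambda>m. (\<lambda>i. if i = j then m else undefined)) ` {1..nat \<lfloor>x\<rfloor>}" by blast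
  qed
  have "card (A {j} x) \<le> nat \<lfloor>x\<rfloor>"
    using card_mono[OF _ sub] card_image_le[of "{1..nat \<lfloor>x\<rfloor>}" "\<lambda>m i. if i = j then m else undefined"]
    by simp
  then have "real (card (A {j} x)) \<le> x"
    using singleton by linarith
  then show ?case using finite_subset[OF sub] by simp
next
  case (insert j I)
  define N where "N = nat \<lfloor>x\<rfloor>"
  have N: "N \<ge> 1" "real N \<le> x" using insert.prems by (auto simp: N_def le_nat_floor)
  \<comment> \<open>Once the coordinate \<open>j\<close> has the value m, the remaining coordinates
    lie under the hyperboloid of level x / m.\<close>
  have sub: "A (insert j I) x \<subseteq> (\<Union>m\<in>{1..N}. (\<lambda>f. f(j := m)) ` A I (x / m))"
  proof
    fix f assume f: "f \<in> A (insert j I) x"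
    \<comment> \<open>Resetting the value at \<open>j\<close> to \<open>undefined\<close> makes the
      restriction extensional on \<open>I\<close>.\<close>
    define g where "g = f(j := undefined)"
    have pos: "f i \<ge> 1" if "i \<in> insert j I" for i
      using f that by (auto simp: A_def PiE_def Pi_def)
    have fg: "f = g(j := f j)" by (simp add: g_def)
    have prodeq: "(\<Prod>i\<in>I. g i) = (\<Prod>i\<in>I. f i)"
      using insert.hyps by (intro prod.cong) (auto simp: g_def)
    have le: "real (f j) * real (\<Prod>i\<in>I. f i) \<le> x"
      using f insert.hyps by (simp add: A_def)
    \<comment> \<open>The other factors multiply to at least 1, so the coordinate \<open>j\<close>
      alone is at most x; this confines it to \<open>{1..N}\<close> and keeps x / m >= 1 for the
      induction hypothesis.\<close>
    have "(\<Prod>i\<in>I. f i) \<ge> 1" using pos by (intro prod_ge_1) auto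
    then have "real (f j) * 1 \<le> real (f j) * real (\<Prod>i\<in>I. f i)"
      by (intro mult_left_mono) linarith+
    then have "real (f j) \<le> x" using le by linarith
    then have fj: "f j \<in> {1..N}" using pos[of j] by (simp add: N_def le_nat_floor)
    have "g \<in> I \<rightarrow>\<^sub>E {1..}"
      using f insert.hyps by (auto simp: A_def g_def PiE_def Pi_def extensional_def)
    moreover have "real (\<Prod>i\<in>I. g i) \<le> x / f j"
      using le fj unfolding prodeq by (simp add: field_simps del: of_nat_prod)
    ultimately have "g \<in> A I (x / f j)" by (simp add: A_def)
    then show "f \<in> (\<Union>m\<in>{1..N}. (\<lambda>f. f(j := m)) ` A I (x / m))"
      using fg fj by blast
  qed
  have IH: "finite (A I (x / m))" "real (card (A I (x / m))) \<le> x / m * (1 + ln x) ^ (card I - 1)"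
    if "m \<in> {1..N}" for m :: nat
  proof -
    have m: "m \<ge> 1" "x / m \<ge> 1" "x / m \<le> x"
      using that N insert.prems by (auto simp: field_simps)
    note * = insert.IH[OF m(2)]
    show "finite (A I (x / m))" using * by blast
    \<comment> \<open>Replacing ln (x / m) by ln x makes the logarithmic factor independent of m, so
      that only a harmonic sum remains.\<close>
    have "1 + ln (x / m) \<le> 1 + ln x" "0 \<le> 1 + ln (x / m)"
      using m insert.prems by (auto intro: add_nonneg_nonneg)
    then have "(1 + ln (x / m)) ^ (card I - 1) \<le> (1 + ln x) ^ (card I - 1)"
      by (intro power_mono)
    then have "x / m * (1 + ln (x / m)) ^ (card I - 1) \<le> x / m * (1 + ln x) ^ (card I - 1)"
      using m by (intro mult_left_mono) auto
    then show "real (card (A I (x / m))) \<le> x / m * (1 + ln x) ^ (card I - 1)"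
      using * by linarith
  qed
  have fin: "finite (\<Union>m\<in>{1..N}. (\<lambda>f. f(j := m)) ` A I (x / m))"
    using IH by auto
  have "card (A (insert j I) x) \<le> card (\<Union>m\<in>{1..N}. (\<lambda>f. f(j := m)) ` A I (x / m))"
    by (rule card_mono[OF fin sub])
  also have "\<dots> \<le> (\<Sum>m=1..N. card ((\<lambda>f. f(j := m)) ` A I (x / m)))"
    by (rule card_UN_le) simp
  also have "\<dots> \<le> (\<Sum>m=1..N. card (A I (x / m)))"
    using IH by (intro sum_mono card_image_le)
  finally have "real (card (A (insert j I) x)) \<le> (\<Sum>m=1..N. real (card (A I (x / m))))"
    by (metis of_nat_le_iff of_nat_sum)
  also have "\<dots> \<le> (\<Sum>m=1..N. x / m * (1 + ln x) ^ (card I - 1))"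
    using IH by (intro sum_mono)
  also have "\<dots> = x * (1 + ln x) ^ (card I - 1) * (\<Sum>m=1..N. 1 / real m)"
    by (subst sum_distrib_left) (simp add: field_simps)
  also have "\<dots> \<le> x * (1 + ln x) ^ (card I - 1) * (1 + ln x)"
  proof (intro mult_left_mono)
    have "ln (real N) \<le> ln x" using N by simp
    then show "(\<Sum>m=1..N. 1 / real m) \<le> 1 + ln x"
      using harm_le_one_plus_ln[OF N(1)] by linarith
  qed (use insert.prems in auto)
  \<comment> \<open>The harmonic sum has cost one more logarithmic factor. As \<open>I\<close> is
    nonempty, it raises the exponent \<open>card I - 1\<close> to exactly
    \<open>card I\<close>.\<close>
  also have "\<dots> = x * (1 + ln x) ^ card I"
    using insert.hyps by (metis (no_types) card_gt_0_iff mult.assoc power_minus_mult)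
  finally show ?case
    using finite_subset[OF sub fin] insert.hyps by simp
qed

section \<open>Counting and finiteness for lattice vectors\<close>

lemma lattice_vol_ge_1: "n \<in> pos_lattice \<Longrightarrow> lattice_vol n \<ge> 1"
  unfolding lattice_vol_def by (intro prod_ge_1) (auto simp: pos_lattice_def Suc_le_eq)

text \<open>The injection \<open>vec_nth\<close> sends these vectors into the set of functions on
  the whole index type that \<open>card_hyperboloid_PiE\<close> counts.\<close>

lemma
  fixes x :: real
  assumes "x \<ge> 1"
  defines "B \<equiv> {n \<in> pos_lattice :: (nat^'d) set. lattice_vol n \<le> x}"
  shows finite_lattice_vol_le: "finite B"
    and card_lattice_vol_le: "real (card B) \<le> x * (1 + ln x) ^ (CARD('d) - 1)"
proof -
  define A where "A = {f \<in> UNIV \<rightarrow>\<^sub>E {1::nat..}. real (\<Prod>i\<in>(UNIV::'d set). f i) \<le> x}"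
  have A: "finite A" "real (card A) \<le> x * (1 + ln x) ^ (CARD('d) - 1)"
    using card_hyperboloid_PiE[of "UNIV :: 'd set" x] assms(1) unfolding A_def by auto
  have inj: "inj_on vec_nth B" by (simp add: inj_on_def vec_nth_inject)
  have "vec_nth ` B \<subseteq> A"
    by (auto simp: A_def B_def pos_lattice_def lattice_vol_def Suc_le_eq)
  then show "finite B" "real (card B) \<le> x * (1 + ln x) ^ (CARD('d) - 1)"
    using A inj card_mono[of A "vec_nth ` B"] finite_subset[of "vec_nth ` B" A]
    by (auto simp: card_image dest: finite_imageD)
qed

text \<open>Countability is what later permits exchanging the lattice sum with the integrals over
  the torus and over the probability space.\<close>

lemma countable_pos_lattice: "countable (pos_lattice :: (nat^'d) set)"
proof -
  \<comment> \<open>The level is \<open>Suc N\<close> rather than \<open>N\<close> because the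
    finiteness result asks for a level of at least 1.\<close>
  have "pos_lattice = (\<Union>N::nat. {n \<in> pos_lattice :: (nat^'d) set. lattice_vol n \<le> real (Suc N)})"
  proof (intro equalityI subsetI)
    fix n :: "nat^'d" assume "n \<in> pos_lattice"
    moreover obtain N :: nat where "lattice_vol n \<le> real N" using real_arch_simple by blast
    then have "lattice_vol n \<le> real (Suc N)" by simp
    ultimately show "n \<in> (\<Union>N::nat. {n \<in> pos_lattice. lattice_vol n \<le> real (Suc N)})" by blast
  qed blast
  moreover have "countable (\<Union>N::nat. {n \<in> pos_lattice :: (nat^'d) set. lattice_vol n \<le> real (Suc N)})"
    by (rule countable_UN) (auto intro!: countable_finite finite_lattice_vol_le)
  ultimately show ?thesis by simp
qed

lemma finite_lattice_box: "finite (lattice_box (n :: nat^'d))"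
proof -
  \<comment> \<open>The vector \<open>n\<close> is arbitrary here and may have a zero coordinate;
    the maximum with 1 keeps the level admissible.\<close>
  have "lattice_box n \<subseteq> {k \<in> pos_lattice. lattice_vol k \<le> max 1 (lattice_vol n)}"
    unfolding lattice_box_def lattice_vol_def
    by (auto simp: less_eq_vec_def intro!: max.coboundedI2 prod_mono)
  then show ?thesis
    by (rule finite_subset) (rule finite_lattice_vol_le, simp)
qed

section \<open>Sums of powers of |n| on either side of a hyperboloid\<close>

text \<open>A constant times the number of points. Lattice sums are written as integrals against the
  counting measure: they live in \<open>ennreal\<close>, need no prior convergence proof and fit
  Tonelli's theorem.\<close>

lemma lattice_sum_below:
  fixes y b :: real
  assumes "y \<ge> 1" "b \<ge> 0"
  shows "(\<integral>\<^sup>+ n. ennreal b * indicator {n. lattice_vol n \<le> y} n \<partial>count_space (pos_lattice :: (nat^'d) set))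
    \<le> ennreal (b * (y * (1 + ln y) ^ (CARD('d) - 1)))"
proof -
  let ?B = "{n \<in> pos_lattice :: (nat^'d) set. lattice_vol n \<le> y}"
  have "(\<integral>\<^sup>+ n. ennreal b * indicator {n. lattice_vol n \<le> y} n \<partial>count_space (pos_lattice :: (nat^'d) set))
     = ennreal b * (\<integral>\<^sup>+ n. indicator ?B n \<partial>count_space (pos_lattice :: (nat^'d) set))"
    by (subst nn_integral_cmult[symmetric]) (auto intro!: nn_integral_cong split: split_indicator)
  also have "(\<integral>\<^sup>+ n. indicator ?B n \<partial>count_space (pos_lattice :: (nat^'d) set)) = ennreal (real (card ?B))"
    using finite_lattice_vol_le[OF assms(1), where 'd='d]
    by (subst nn_integral_indicator) (auto simp: emeasure_count_space ennreal_of_nat_eq_real_of_nat)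
  also have "ennreal b * ennreal (real (card ?B)) \<le> ennreal (b * (y * (1 + ln y) ^ (CARD('d) - 1)))"
    using card_lattice_vol_le[OF assms(1), where 'd='d] assms
    by (subst ennreal_mult[symmetric]) (auto intro!: ennreal_leI mult_left_mono)
  finally show ?thesis .
qed

text \<open>The tail is decomposed into the dyadic shells \<open>2 ^ j * y \<le> |n| < 2 ^ (j + 1) * y\<close>.\<close>

lemma lattice_sum_above:
  fixes \<delta> :: real
  assumes "\<delta> > 0"
  obtains C where "C \<ge> 0"
    "\<And>y. y \<ge> 1 \<Longrightarrow> (\<integral>\<^sup>+ n. ennreal (lattice_vol n powr (- 1 - \<delta>)) * indicator {n. y \<le> lattice_vol n} n
        \<partial>count_space (pos_lattice :: (nat^'d) set)) \<le> ennreal (C * (y powr - \<delta> * (1 + ln y) ^ (CARD('d) - 1)))"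
proof -
  define D where "D = CARD('d) - 1"
  \<comment> \<open>On the shell j the summand is at most its value at the lower edge 2^j y, and the
    points are counted up to the upper edge 2^(j+1) y. The part of this product that depends on j
    alone is \<open>c j\<close>; its factor 2 is the ratio of the two edges.\<close>
  define c :: "nat \<Rightarrow> real" where "c j = 2 * (2 powr - \<delta>) ^ j * (1 + (real j + 1) * ln 2) ^ D" for j
  have "summable c"
  proof -
    \<comment> \<open>The value is chosen so that the D-th power of exp (\<eta> (2 + j)) uses up
      only half of the geometric decay 2^(-\<delta> j), leaving the ratio q = 2^(-\<delta>/2). The
      added 1 keeps the denominator nonzero in dimension one, where D = 0.\<close>
    define \<eta> where "\<eta> = \<delta> * ln 2 / (2 * (real D + 1))"
    define q where "q = exp (- (\<delta> * ln 2 / 2))"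
    have \<eta>: "\<eta> > 0" "real D * \<eta> \<le> \<delta> * ln 2 / 2" using assms by (auto simp: \<eta>_def field_simps)
    have bound: "norm (c j) \<le> 2 / \<eta> ^ D * exp (\<delta> * ln 2) * q ^ j" for j
    proof -
      \<comment> \<open>The linear factor is beaten by an exponential through u <= exp u at u =
        \<eta> (2 + j).\<close>
      have "\<eta> * (1 + (real j + 1) * ln 2) \<le> \<eta> * (2 + real j)"
      proof (intro mult_left_mono)
        have "ln (2::real) \<le> 1" using ln_le_minus_one[of "2::real"] by simp
        then have "(real j + 1) * ln 2 \<le> real j + 1" by (intro mult_left_le) auto
        then show "1 + (real j + 1) * ln 2 \<le> 2 + real j" by linarith
      qed (use \<eta> in simp)
      also have "\<dots> \<le> exp (\<eta> * (2 + real j))" using exp_ge_add_one_self[of "\<eta> * (2 + real j)"] by linarith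
      finally have "1 + (real j + 1) * ln 2 \<le> exp (\<eta> * (2 + real j)) / \<eta>"
        using \<eta> by (simp add: field_simps)
      then have "(1 + (real j + 1) * ln 2) ^ D \<le> (exp (\<eta> * (2 + real j)) / \<eta>) ^ D"
        by (intro power_mono) auto
      also have "\<dots> = exp ((real D * \<eta>) * (2 + real j)) / \<eta> ^ D"
        by (simp add: power_divide exp_of_nat_mult[symmetric] mult.assoc)
      also have "\<dots> \<le> exp ((\<delta> * ln 2 / 2) * (2 + real j)) / \<eta> ^ D"
        using \<eta> by (intro divide_right_mono) (auto intro!: mult_right_mono)
      finally have "c j \<le> 2 * (2 powr - \<delta>) ^ j * (exp ((\<delta> * ln 2 / 2) * (2 + real j)) / \<eta> ^ D)"
        unfolding c_def by (intro mult_left_mono) auto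
      also have "(2 powr - \<delta>) ^ j = exp (- (real j * (\<delta> * ln 2)))"
        by (simp add: powr_def exp_of_nat_mult[symmetric])
      also have "2 * exp (- (real j * (\<delta> * ln 2))) * (exp ((\<delta> * ln 2 / 2) * (2 + real j)) / \<eta> ^ D)
          = 2 / \<eta> ^ D * exp (\<delta> * ln 2 + real j * - (\<delta> * ln 2 / 2))"
        by (simp add: exp_add[symmetric] field_simps)
      also have "\<dots> = 2 / \<eta> ^ D * exp (\<delta> * ln 2) * q ^ j"
        by (simp only: exp_add exp_of_nat_mult q_def mult.assoc)
      finally show ?thesis by (simp add: c_def)
    qed
    have "summable (\<lambda>j. 2 / \<eta> ^ D * exp (\<delta> * ln 2) * q ^ j)"
      using assms by (intro summable_mult summable_geometric) (simp add: q_def)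
    then show ?thesis
      by (rule summable_comparison_test'[where N=0]) (rule bound)
  qed
  have c_nonneg: "c j \<ge> 0" for j by (simp add: c_def)
  show thesis
  proof (rule that[of "suminf c"])
    show "suminf c \<ge> 0" by (intro suminf_nonneg \<open>summable c\<close> c_nonneg)
    fix y :: real assume y: "y \<ge> 1"
    let ?P = "pos_lattice :: (nat^'d) set"
    define b where "b j = (2 ^ j * y) powr (- 1 - \<delta>)" for j :: nat
    \<comment> \<open>Only an upper bound is wanted, so each shell is enlarged to the full region
      below its upper edge, to which \<open>lattice_sum_below\<close> applies.\<close>
    have "(\<integral>\<^sup>+ n. ennreal (lattice_vol n powr (- 1 - \<delta>)) * indicator {n. y \<le> lattice_vol n} n \<partial>count_space ?P)
      \<le> (\<integral>\<^sup>+ n. (\<Sum>j. ennreal (b j) * indicator {n. lattice_vol n \<le> 2 ^ (j + 1) * y} n) \<partial>count_space ?P)"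
    proof (intro nn_integral_mono)
      fix n :: "nat^'d" assume "n \<in> space (count_space ?P)"
      define v where "v = lattice_vol n"
      have "ennreal (v powr (- 1 - \<delta>)) \<le> (\<Sum>j. ennreal (b j) * indicator {n. lattice_vol n \<le> 2 ^ (j + 1) * y} n)"
        if "y \<le> v"
      proof -
        define j where "j = nat \<lfloor>log 2 (v / y)\<rfloor>"
        have vy: "v / y \<ge> 1" "v > 0" using that y by auto
        then have l0: "log 2 (v / y) \<ge> 0" by simp
        then have "real j \<le> log 2 (v / y)" "log 2 (v / y) \<le> real (j + 1)"
          unfolding j_def by linarith+
        then have "2 powr real j \<le> v / y" "v / y \<le> 2 powr real (j + 1)"
          using vy by (simp_all add: le_log_iff log_le_iff)
        then have j: "2 ^ j * y \<le> v" "v \<le> 2 ^ (j + 1) * y"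
          using y unfolding powr_realpow[OF zero_less_numeral] by (simp_all add: field_simps)
        have "v powr (- 1 - \<delta>) \<le> b j"
          unfolding b_def using j y assms by (intro powr_mono2') auto
        then have "ennreal (v powr (- 1 - \<delta>)) \<le> ennreal (b j) * indicator {n. lattice_vol n \<le> 2 ^ (j + 1) * y} n"
          using j by (simp add: v_def ennreal_leI)
        also have "\<dots> \<le> (\<Sum>j. ennreal (b j) * indicator {n. lattice_vol n \<le> 2 ^ (j + 1) * y} n)"
        proof -
          define g where "g j = ennreal (b j) * indicator {n. lattice_vol n \<le> 2 ^ (j + 1) * y} n" for j
          have "g j \<le> suminf g" using sum_le_suminf[of g "{j}"] by simp
          then show ?thesis unfolding g_def .
        qed
        finally show ?thesis .
      qed
      then show "ennreal (lattice_vol n powr (- 1 - \<delta>)) * indicator {n. y \<le> lattice_vol n} n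
        \<le> (\<Sum>j. ennreal (b j) * indicator {n. lattice_vol n \<le> 2 ^ (j + 1) * y} n)"
        by (auto simp: v_def split: split_indicator)
    qed
    also have "\<dots> = (\<Sum>j. \<integral>\<^sup>+ n. ennreal (b j) * indicator {n. lattice_vol n \<le> 2 ^ (j + 1) * y} n \<partial>count_space ?P)"
      by (intro nn_integral_suminf) simp
    also have "\<dots> \<le> (\<Sum>j. ennreal (c j * (y powr - \<delta> * (1 + ln y) ^ D)))"
    proof (intro suminf_le allI)
      fix j :: nat
      have y2: "2 ^ (j + 1) * y \<ge> 1"
        using y mult_mono[of 1 "2 ^ (j + 1)" 1 y] one_le_power[of "2::real" "j + 1"] by simp
      have "(\<integral>\<^sup>+ n. ennreal (b j) * indicator {n. lattice_vol n \<le> 2 ^ (j + 1) * y} n \<partial>count_space ?P)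
        \<le> ennreal (b j * ((2 ^ (j + 1) * y) * (1 + ln (2 ^ (j + 1) * y)) ^ D))"
        unfolding D_def by (intro lattice_sum_below y2) (simp add: b_def)
      also have "\<dots> \<le> ennreal (c j * (y powr - \<delta> * (1 + ln y) ^ D))"
      proof (intro ennreal_leI)
        \<comment> \<open>With s = (j + 1) ln 2 and l = ln y, both nonnegative, 1 + s + l <= (1 + s)
          (1 + l); this separates j from y.\<close>
        have "ln (2 ^ (j + 1) * y) = (real j + 1) * ln 2 + ln y"
          using y by (subst ln_mult) (auto simp: ln_realpow simp del: power_Suc)
        moreover have "(1 + (real j + 1) * ln 2) * (1 + ln y) = 1 + (real j + 1) * ln 2 + ln y + (real j + 1) * ln 2 * ln y"
          by (simp add: algebra_simps)
        moreover have "0 \<le> (real j + 1) * ln 2 * ln y" using y by simp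
        ultimately have "1 + ln (2 ^ (j + 1) * y) \<le> (1 + (real j + 1) * ln 2) * (1 + ln y)" by linarith
        then have 1: "(1 + ln (2 ^ (j + 1) * y)) ^ D \<le> ((1 + (real j + 1) * ln 2) * (1 + ln y)) ^ D"
          using y2 by (intro power_mono) (auto intro!: add_nonneg_nonneg ln_ge_zero simp del: power_Suc)
        \<comment> \<open>The linear growth of the count cancels the exponent -1 and leaves the
          decay of order -\<delta>.\<close>
        have "b j * (2 ^ (j + 1) * y) = 2 * ((2 ^ j * y) powr (- 1 - \<delta>) * (2 ^ j * y) powr 1)"
          using y by (simp add: b_def)
        also have "\<dots> = 2 * (2 ^ j * y) powr - \<delta>"
          by (subst powr_add[symmetric]) simp
        also have "\<dots> = 2 * (2 powr - \<delta>) ^ j * y powr - \<delta>"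
          using y by (simp add: powr_mult powr_power powr_realpow[symmetric] powr_powr mult.commute)
        finally have 2: "b j * (2 ^ (j + 1) * y) = 2 * (2 powr - \<delta>) ^ j * y powr - \<delta>" .
        have "b j * ((2 ^ (j + 1) * y) * (1 + ln (2 ^ (j + 1) * y)) ^ D) =
           (2 * (2 powr - \<delta>) ^ j * y powr - \<delta>) * (1 + ln (2 ^ (j + 1) * y)) ^ D"
          by (subst 2[symmetric]) (simp only: mult.assoc)
        also have "\<dots> \<le> (2 * (2 powr - \<delta>) ^ j * y powr - \<delta>) * ((1 + (real j + 1) * ln 2) * (1 + ln y)) ^ D"
          by (intro mult_left_mono 1) auto
        also have "\<dots> = c j * (y powr - \<delta> * (1 + ln y) ^ D)"
          by (simp add: c_def power_mult_distrib mult_ac)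
        finally show "b j * ((2 ^ (j + 1) * y) * (1 + ln (2 ^ (j + 1) * y)) ^ D) \<le> c j * (y powr - \<delta> * (1 + ln y) ^ D)" .
      qed
      finally show "(\<integral>\<^sup>+ n. ennreal (b j) * indicator {n. lattice_vol n \<le> 2 ^ (j + 1) * y} n \<partial>count_space ?P)
        \<le> ennreal (c j * (y powr - \<delta> * (1 + ln y) ^ D))" .
    qed auto
    also have "\<dots> = ennreal (suminf c * (y powr - \<delta> * (1 + ln y) ^ D))"
      using \<open>summable c\<close> c_nonneg y
      by (subst suminf_ennreal2) (auto simp: suminf_mult2[symmetric] intro: summable_mult2)
    finally show "(\<integral>\<^sup>+ n. ennreal (lattice_vol n powr (- 1 - \<delta>)) * indicator {n. y \<le> lattice_vol n} n
        \<partial>count_space ?P) \<le> ennreal (suminf c * (y powr - \<delta> * (1 + ln y) ^ (CARD('d) - 1)))"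
      by (simp add: D_def)
  qed
qed

text \<open>The minimum switches at |n| = |x|^r. Below, the summand is at most |n|^(p/r - 1), which
  r <= p makes nondecreasing, so the count times the edge value applies; above, it is x^2 |n|^(-1 -
  \<delta>), whose tail \<open>lattice_sum_above\<close> controls. Both parts have the size |x|^p
  times a power of the logarithm.\<close>

lemma lattice_kernel_bound:
  fixes p r :: real
  assumes "1 < p" "p < 2" "1 \<le> r" "r \<le> p"
  obtains C where "C \<ge> 0"
    "\<And>x. (\<integral>\<^sup>+ n. ennreal (lattice_vol n powr (p / r - 1 - 2 / r) * min (x\<^sup>2) ((lattice_vol n powr (1 / r))\<^sup>2))
        \<partial>count_space (pos_lattice :: (nat^'d) set)) \<le> ennreal (C * (\<bar>x\<bar> powr p * log_plus \<bar>x\<bar> ^ (CARD('d) - 1)))"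
proof -
  define D where "D = CARD('d) - 1"
  \<comment> \<open>The margin by which the exponent p/r - 1 - 2/r lies below the critical value -1;
    it is positive because p < 2.\<close>
  define \<delta> where "\<delta> = (2 - p) / r"
  have \<delta>: "\<delta> > 0" using assms by (simp add: \<delta>_def)
  have expo: "p / r - 1 - 2 / r = - 1 - \<delta>" using assms by (simp add: \<delta>_def field_simps)
  let ?P = "pos_lattice :: (nat^'d) set"
  obtain C0 where C0: "C0 \<ge> 0"
    "\<And>y. y \<ge> 1 \<Longrightarrow> (\<integral>\<^sup>+ n. ennreal (lattice_vol n powr (- 1 - \<delta>)) * indicator {n. y \<le> lattice_vol n} n
        \<partial>count_space ?P) \<le> ennreal (C0 * (y powr - \<delta> * (1 + ln y) ^ D))"
    using lattice_sum_above[OF \<delta>, where 'd='d] unfolding D_def by blast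
  show thesis
  proof (rule that[of "(1 + C0) * (1 + r) ^ D"])
    show "(1 + C0) * (1 + r) ^ D \<ge> 0" using C0 assms by simp
    fix x :: real
    \<comment> \<open>The switching level, raised to 1 so that the counting bounds apply.\<close>
    define y where "y = max 1 (\<bar>x\<bar> powr r)"
    \<comment> \<open>A bound for the summand strictly below the level y. For |x| <= 1 the level is
      1 and no lattice point lies below it, so 0 is allowed; a fixed positive value would not be
      dominated by |x|^p as x tends to 0.\<close>
    define b where "b = (if \<bar>x\<bar> > 1 then y powr (p / r - 1) else 0)"
    have y: "y \<ge> 1" by (simp add: y_def)
    have b: "b \<ge> 0" by (simp add: b_def)
    have y_big: "y = \<bar>x\<bar> powr r" if "\<bar>x\<bar> > 1"
      using that assms ge_one_powr_ge_zero[of "\<bar>x\<bar>" r] by (simp add: y_def)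
    have y_small: "y = 1" if "\<bar>x\<bar> \<le> 1"
      using that assms powr_le1[of r "\<bar>x\<bar>"] by (simp add: y_def)
    have by_le: "b * y \<le> \<bar>x\<bar> powr p"
    proof (cases "\<bar>x\<bar> > 1")
      case True
      then have "b * y = y powr (p / r - 1) * y powr 1" using y by (simp add: b_def)
      also have "\<dots> = y powr (p / r)" by (subst powr_add[symmetric]) simp
      also have "\<dots> = \<bar>x\<bar> powr p" using assms True by (simp add: y_big powr_powr)
      finally show ?thesis by simp
    qed (simp add: b_def)
    have xy_le: "x\<^sup>2 * y powr - \<delta> \<le> \<bar>x\<bar> powr p"
    proof (cases "\<bar>x\<bar> > 1")
      case True
      then have "x\<^sup>2 * y powr - \<delta> = \<bar>x\<bar> powr 2 * \<bar>x\<bar> powr (r * - \<delta>)"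
        by (simp add: y_big powr_powr)
      also have "\<dots> = \<bar>x\<bar> powr (2 + r * - \<delta>)" by (rule powr_add[symmetric])
      also have "2 + r * - \<delta> = p" using assms by (simp add: \<delta>_def)
      finally show ?thesis by simp
    next
      \<comment> \<open>Here y = 1 and the claim is x^2 <= |x|^p, which holds for |x| <= 1 since p <
        2.\<close>
      case False
      show ?thesis
      proof (cases "x = 0")
        case False
        then have "\<bar>x\<bar> powr 2 \<le> \<bar>x\<bar> powr p"
          using \<open>\<not> \<bar>x\<bar> > 1\<close> assms by (intro powr_mono') auto
        then show ?thesis using False \<open>\<not> \<bar>x\<bar> > 1\<close> by (simp add: y_small)
      qed simp
    qed
    \<comment> \<open>The cut-off of \<open>log_plus\<close> at 1 absorbs the additive constant, and
      ln y = r ln |x| accounts for the factor r.\<close>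
    have ln_le: "1 + ln y \<le> (1 + r) * log_plus \<bar>x\<bar>"
    proof (cases "\<bar>x\<bar> > 1")
      case True
      then have "1 + ln y = 1 + r * ln \<bar>x\<bar>" by (simp add: y_big ln_powr)
      also have "\<dots> \<le> log_plus \<bar>x\<bar> + r * log_plus \<bar>x\<bar>"
        using assms by (intro add_mono mult_left_mono) (auto simp: log_plus_def)
      finally show ?thesis by (simp add: algebra_simps)
    next
      case False
      have "1 * 1 \<le> (1 + r) * log_plus \<bar>x\<bar>"
        using assms by (intro mult_mono) (auto simp: log_plus_def)
      then show ?thesis using False by (simp add: y_small)
    qed
    have pow_le: "(1 + ln y) ^ D \<le> (1 + r) ^ D * log_plus \<bar>x\<bar> ^ D"
      unfolding power_mult_distrib[symmetric] using y by (intro power_mono ln_le) auto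
    \<comment> \<open>Both regions contain the edge |n| = y; counting it twice only enlarges the
      upper bound.\<close>
    have "(\<integral>\<^sup>+ n. ennreal (lattice_vol n powr (p / r - 1 - 2 / r) * min (x\<^sup>2) ((lattice_vol n powr (1 / r))\<^sup>2)) \<partial>count_space ?P)
      \<le> (\<integral>\<^sup>+ n. ennreal b * indicator {n. lattice_vol n \<le> y} n +
            ennreal (x\<^sup>2) * (ennreal (lattice_vol n powr (- 1 - \<delta>)) * indicator {n. y \<le> lattice_vol n} n) \<partial>count_space ?P)"
    proof (intro nn_integral_mono)
      fix n :: "nat^'d" assume "n \<in> space (count_space ?P)"
      define v where "v = lattice_vol n"
      have v: "v \<ge> 1" using \<open>n \<in> _\<close> by (simp add: v_def lattice_vol_ge_1)
      show "ennreal (lattice_vol n powr (p / r - 1 - 2 / r) * min (x\<^sup>2) ((lattice_vol n powr (1 / r))\<^sup>2))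
        \<le> ennreal b * indicator {n. lattice_vol n \<le> y} n +
            ennreal (x\<^sup>2) * (ennreal (lattice_vol n powr (- 1 - \<delta>)) * indicator {n. y \<le> lattice_vol n} n)"
      proof (cases "y \<le> v")
        case True
        have "v powr (p / r - 1 - 2 / r) * min (x\<^sup>2) ((v powr (1 / r))\<^sup>2) \<le> v powr (- 1 - \<delta>) * x\<^sup>2"
          unfolding expo by (intro mult_left_mono) auto
        then have "ennreal (v powr (p / r - 1 - 2 / r) * min (x\<^sup>2) ((v powr (1 / r))\<^sup>2)) \<le> ennreal (x\<^sup>2) * ennreal (v powr (- 1 - \<delta>))"
          by (subst ennreal_mult[symmetric]) (auto intro!: ennreal_leI simp: mult.commute)
        then show ?thesis using True by (auto simp: v_def intro: add_increasing)
      next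
        case False
        then have x: "\<bar>x\<bar> > 1" using y_small v by (cases "\<bar>x\<bar> \<le> 1") auto
        have "v powr (p / r - 1 - 2 / r) * min (x\<^sup>2) ((v powr (1 / r))\<^sup>2) \<le> v powr (p / r - 1 - 2 / r) * v powr (2 / r)"
          using v by (intro mult_left_mono) (auto simp: powr_power)
        also have "\<dots> = v powr (p / r - 1)" by (subst powr_add[symmetric]) simp
        also have "\<dots> \<le> b"
          using x False v assms by (auto simp: b_def intro!: powr_mono2)
        finally show ?thesis using False by (auto simp: v_def intro: ennreal_leI)
      qed
    qed
    also have "\<dots> = (\<integral>\<^sup>+ n. ennreal b * indicator {n. lattice_vol n \<le> y} n \<partial>count_space ?P) +
        ennreal (x\<^sup>2) * (\<integral>\<^sup>+ n. ennreal (lattice_vol n powr (- 1 - \<delta>)) * indicator {n. y \<le> lattice_vol n} n \<partial>count_space ?P)"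
      by (subst nn_integral_add) (auto simp: nn_integral_cmult)
    also have "\<dots> \<le> ennreal (b * (y * (1 + ln y) ^ D)) + ennreal (x\<^sup>2) * ennreal (C0 * (y powr - \<delta> * (1 + ln y) ^ D))"
      unfolding D_def by (intro add_mono mult_left_mono lattice_sum_below C0(2)[unfolded D_def] y b) auto
    also have "\<dots> = ennreal ((b * y) * (1 + ln y) ^ D + C0 * ((x\<^sup>2 * y powr - \<delta>) * (1 + ln y) ^ D))"
      using b y C0 by (simp add: ennreal_mult[symmetric] ennreal_plus[symmetric] mult_ac del: ennreal_plus)
    also have "\<dots> \<le> ennreal (((1 + C0) * (1 + r) ^ D) * (\<bar>x\<bar> powr p * log_plus \<bar>x\<bar> ^ D))"
    proof (intro ennreal_leI)
      have "(b * y) * (1 + ln y) ^ D + C0 * ((x\<^sup>2 * y powr - \<delta>) * (1 + ln y) ^ D)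
        \<le> \<bar>x\<bar> powr p * ((1 + r) ^ D * log_plus \<bar>x\<bar> ^ D) + C0 * (\<bar>x\<bar> powr p * ((1 + r) ^ D * log_plus \<bar>x\<bar> ^ D))"
        using y C0 by (intro add_mono mult_left_mono mult_mono by_le xy_le pow_le) auto
      also have "\<dots> = ((1 + C0) * (1 + r) ^ D) * (\<bar>x\<bar> powr p * log_plus \<bar>x\<bar> ^ D)"
        by (simp add: algebra_simps)
      finally show "(b * y) * (1 + ln y) ^ D + C0 * ((x\<^sup>2 * y powr - \<delta>) * (1 + ln y) ^ D)
        \<le> ((1 + C0) * (1 + r) ^ D) * (\<bar>x\<bar> powr p * log_plus \<bar>x\<bar> ^ D)" .
    qed
    finally show "(\<integral>\<^sup>+ n. ennreal (lattice_vol n powr (p / r - 1 - 2 / r) * min (x\<^sup>2) ((lattice_vol n powr (1 / r))\<^sup>2))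
        \<partial>count_space ?P) \<le> ennreal ((1 + C0) * (1 + r) ^ D * (\<bar>x\<bar> powr p * log_plus \<bar>x\<bar> ^ (CARD('d) - 1)))"
      by (simp add: D_def)
  qed
qed

subsection \<open>Truncated second moments\<close>

text \<open>Layer-cake representation, from \<open>min (y\<^sup>2) (a\<^sup>2) = \<integral>\<^sub>0\<^sup>a 2 x 1(x < y) dx\<close>.\<close>

lemma nn_integral_truncated_square:
  fixes f :: "'a \<Rightarrow> real"
  assumes "sigma_finite_measure P" and [measurable]: "f \<in> borel_measurable P" and "a \<ge> 0"
  shows "(\<integral>\<^sup>+ \<omega>. ennreal (min ((f \<omega>)\<^sup>2) (a\<^sup>2)) \<partial>P) =
    (\<integral>\<^sup>+ x. ennreal (2 * x) * indicator {0..a} x * emeasure P {\<omega>\<in>space P. \<bar>f \<omega>\<bar> > x} \<partial>lborel)"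
proof -
  interpret sigma_finite_measure P by fact
  interpret L: pair_sigma_finite lborel P ..
  have "ennreal (min ((f \<omega>)\<^sup>2) (a\<^sup>2)) =
      (\<integral>\<^sup>+ x. ennreal (2 * x) * indicator {0..a} x * indicator {x. \<bar>f \<omega>\<bar> > x} x \<partial>lborel)" for \<omega>
  proof -
    define c where "c = min \<bar>f \<omega>\<bar> a"
    have c: "0 \<le> c" using assms by (simp add: c_def)
    \<comment> \<open>The two integrands differ at most at the single point x = |f \<omega>|, a null
      set.\<close>
    have "(\<integral>\<^sup>+ x. ennreal (2 * x) * indicator {0..a} x * indicator {x. \<bar>f \<omega>\<bar> > x} x \<partial>lborel)
       = (\<integral>\<^sup>+ x. ennreal (2 * x) * indicator {0..c} x \<partial>lborel)"
      by (rule nn_integral_cong_AE, rule AE_mp[OF AE_lborel_singleton[of "\<bar>f \<omega>\<bar>"]])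
         (auto simp: c_def indicator_def)
    also have "\<dots> = ennreal (c\<^sup>2 - 0\<^sup>2)"
      by (intro nn_integral_FTC_Icc) (use c in \<open>auto intro!: derivative_eq_intros\<close>)
    also have "c\<^sup>2 - 0\<^sup>2 = min ((f \<omega>)\<^sup>2) (a\<^sup>2)"
      using assms(3) abs_le_square_iff[of "f \<omega>" a] abs_le_square_iff[of a "f \<omega>"]
      by (auto simp: c_def min_def)
    finally show ?thesis by simp
  qed
  then have "(\<integral>\<^sup>+ \<omega>. ennreal (min ((f \<omega>)\<^sup>2) (a\<^sup>2)) \<partial>P) =
     (\<integral>\<^sup>+ \<omega>. \<integral>\<^sup>+ x. ennreal (2 * x) * indicator {0..a} x * indicator {x. \<bar>f \<omega>\<bar> > x} x \<partial>lborel \<partial>P)"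
    by simp
  also have "\<dots> = (\<integral>\<^sup>+ x. \<integral>\<^sup>+ \<omega>. ennreal (2 * x) * indicator {0..a} x * indicator {x. \<bar>f \<omega>\<bar> > x} x \<partial>P \<partial>lborel)"
    by (intro L.Fubini') measurable
  also have "\<dots> = (\<integral>\<^sup>+ x. ennreal (2 * x) * indicator {0..a} x * emeasure P {\<omega>\<in>space P. \<bar>f \<omega>\<bar> > x} \<partial>lborel)"
  proof (intro nn_integral_cong)
    fix x :: real
    have "(\<integral>\<^sup>+ \<omega>. ennreal (2 * x) * indicator {0..a} x * indicator {x. \<bar>f \<omega>\<bar> > x} x \<partial>P) =
       (\<integral>\<^sup>+ \<omega>. ennreal (2 * x) * indicator {0..a} x * indicator {\<omega>\<in>space P. \<bar>f \<omega>\<bar> > x} \<omega> \<partial>P)"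
      by (intro nn_integral_cong) (auto split: split_indicator)
    also have "\<dots> = ennreal (2 * x) * indicator {0..a} x * emeasure P {\<omega>\<in>space P. \<bar>f \<omega>\<bar> > x}"
      by (subst nn_integral_cmult) auto
    finally show "(\<integral>\<^sup>+ \<omega>. ennreal (2 * x) * indicator {0..a} x * indicator {x. \<bar>f \<omega>\<bar> > x} x \<partial>P) =
       ennreal (2 * x) * indicator {0..a} x * emeasure P {\<omega>\<in>space P. \<bar>f \<omega>\<bar> > x}" .
  qed
  finally show ?thesis .
qed

text \<open>The layer-cake weight 2x on [0, a] is the same for every variable and vanishes for
  negative x, so the domination of the tails can be integrated against it.\<close>

lemma (in prob_space) sum_truncated_square_le:
  fixes X :: "'a \<Rightarrow> real" and Y :: "'k \<Rightarrow> 'a \<Rightarrow> real"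
  assumes [measurable]: "X \<in> borel_measurable M" "\<And>k. k \<in> K \<Longrightarrow> Y k \<in> borel_measurable M"
    and "a \<ge> 0" "C \<ge> 0"
    and dom: "\<And>x. x \<ge> 0 \<Longrightarrow> (\<Sum>k\<in>K. \<P>(\<omega> in M. \<bar>Y k \<omega>\<bar> > x)) \<le> C * \<P>(\<omega> in M. \<bar>X \<omega>\<bar> > x)"
  shows "(\<Sum>k\<in>K. \<integral>\<^sup>+ \<omega>. ennreal (min ((Y k \<omega>)\<^sup>2) (a\<^sup>2)) \<partial>M)
    \<le> ennreal C * (\<integral>\<^sup>+ \<omega>. ennreal (min ((X \<omega>)\<^sup>2) (a\<^sup>2)) \<partial>M)"
proof -
  let ?w = "\<lambda>x. ennreal (2 * x) * indicator {0..a} x"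
  have "(\<Sum>k\<in>K. \<integral>\<^sup>+ \<omega>. ennreal (min ((Y k \<omega>)\<^sup>2) (a\<^sup>2)) \<partial>M) =
     (\<Sum>k\<in>K. \<integral>\<^sup>+ x. ?w x * emeasure M {\<omega>\<in>space M. \<bar>Y k \<omega>\<bar> > x} \<partial>lborel)"
    using assms by (intro sum.cong refl nn_integral_truncated_square sigma_finite_measure_axioms) auto
  also have "\<dots> = (\<integral>\<^sup>+ x. (\<Sum>k\<in>K. ?w x * emeasure M {\<omega>\<in>space M. \<bar>Y k \<omega>\<bar> > x}) \<partial>lborel)"
    by (intro nn_integral_sum[symmetric]) measurable
  also have "\<dots> \<le> (\<integral>\<^sup>+ x. ennreal C * (?w x * emeasure M {\<omega>\<in>space M. \<bar>X \<omega>\<bar> > x}) \<partial>lborel)"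
  proof (intro nn_integral_mono)
    fix x :: real
    have "(\<Sum>k\<in>K. emeasure M {\<omega>\<in>space M. \<bar>Y k \<omega>\<bar> > x}) \<le> ennreal C * emeasure M {\<omega>\<in>space M. \<bar>X \<omega>\<bar> > x}"
      if "x \<ge> 0"
      using dom[OF that] assms(4)
      by (simp add: emeasure_eq_measure sum_ennreal ennreal_mult[symmetric] ennreal_leI sum_nonneg)
    then show "(\<Sum>k\<in>K. ?w x * emeasure M {\<omega>\<in>space M. \<bar>Y k \<omega>\<bar> > x})
        \<le> ennreal C * (?w x * emeasure M {\<omega>\<in>space M. \<bar>X \<omega>\<bar> > x})"
      by (auto simp: sum_distrib_left[symmetric] mult.left_commute[of "ennreal C"]
            split: split_indicator intro!: mult_left_mono)
  qed
  also have "\<dots> = ennreal C * (\<integral>\<^sup>+ x. ?w x * emeasure M {\<omega>\<in>space M. \<bar>X \<omega>\<bar> > x} \<partial>lborel)"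
    by (intro nn_integral_cmult) measurable
  also have "(\<integral>\<^sup>+ x. ?w x * emeasure M {\<omega>\<in>space M. \<bar>X \<omega>\<bar> > x} \<partial>lborel)
     = (\<integral>\<^sup>+ \<omega>. ennreal (min ((X \<omega>)\<^sup>2) (a\<^sup>2)) \<partial>M)"
    using assms by (intro nn_integral_truncated_square[symmetric] sigma_finite_measure_axioms) auto
  finally show ?thesis .
qed

subsection \<open>Trigonometric sums on the torus\<close>

text \<open>Fubini for products of one-variable functions: \<open>lborel_eq\<close> presents
  Lebesgue measure as an image of a product measure.\<close>

lemma
  fixes f :: "'d::finite \<Rightarrow> real \<Rightarrow> complex"
  assumes f: "\<And>i. integrable lborel (f i)"
  shows integrable_prod_vec: "integrable lborel (\<lambda>t::real^'d. \<Prod>i\<in>UNIV. f i (t $ i))"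
    and integral_prod_vec: "(LINT t|lborel. (\<Prod>i\<in>UNIV. f i ((t::real^'d) $ i))) = (\<Prod>i\<in>UNIV. LINT x|lborel. f i x)"
proof -
  interpret product_sigma_finite "\<lambda>_::real^'d. lborel :: real measure" ..
  \<comment> \<open>The product measure is indexed by \<open>Basis\<close>, the factors by the index
    type; \<open>e\<close> matches the two and \<open>h\<close> is the family \<open>f\<close>
    reindexed along it.\<close>
  define e :: "'d \<Rightarrow> real^'d" where "e i = axis i 1" for i
  have e: "bij_betw e UNIV Basis"
    by (auto simp: bij_betw_def e_def inj_on_def axis_eq_axis Basis_vec_def)
  define h where "h b = f (the_inv_into UNIV e b)" for b
  have he: "h (e i) = f i" for i
    using e by (simp add: h_def the_inv_into_f_f bij_betw_def)
  let ?B = "Basis :: (real^'d) set"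
  let ?g = "\<lambda>x::real^'d \<Rightarrow> real. \<Sum>b\<in>?B. x b *\<^sub>R b"
  have [measurable]: "f i \<in> borel_measurable borel" for i
    using borel_measurable_integrable[OF f] by simp
  have comp: "?g x $ i = x (e i)" for x i
  proof -
    have "?g x $ i = ?g x \<bullet> e i" by (simp add: e_def inner_axis)
    also have "\<dots> = x (e i)"
      by (rule inner_sum_left_Basis) (simp add: e_def)
    finally show ?thesis .
  qed
  have prodeq: "(\<Prod>i\<in>UNIV. f i (?g x $ i)) = (\<Prod>b\<in>?B. h b (x b))" for x
    unfolding comp by (subst prod.reindex_bij_betw[OF e, symmetric]) (simp add: he)
  have h: "integrable lborel (h b)" for b by (simp add: h_def f)
  have g[measurable]: "?g \<in> measurable (Pi\<^sub>M ?B (\<lambda>_. lborel)) borel" by measurable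
  have m[measurable]: "(\<lambda>t::real^'d. \<Prod>i\<in>UNIV. f i (t $ i)) \<in> borel_measurable borel" by measurable
  show "integrable lborel (\<lambda>t::real^'d. \<Prod>i\<in>UNIV. f i (t $ i))"
    unfolding lborel_eq[where 'a="real^'d"]
    by (subst integrable_distr_eq[OF g m]) (simp only: prodeq, intro product_integrable_prod h finite_Basis)
  show "(LINT t|lborel. (\<Prod>i\<in>UNIV. f i ((t::real^'d) $ i))) = (\<Prod>i\<in>UNIV. LINT x|lborel. f i x)"
    unfolding lborel_eq[where 'a="real^'d"]
    by (subst integral_distr[OF g m], simp only: prodeq, subst product_integral_prod)
       (auto simp: h prod.reindex_bij_betw[OF e, symmetric] he)
qed

text \<open>For m \<noteq> 0 the antiderivative exp (i m x) / (i m) has equal values at -pi and pi.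
  The fundamental theorem is applied on the closed interval, which differs from the half-open one by
  a null set.\<close>

lemma has_bochner_integral_cis_period:
  fixes m :: int
  shows "has_bochner_integral lborel
    (\<lambda>x. indicator {-pi..<pi} x *\<^sub>R exp (\<i> * complex_of_real (of_int m * x))) (if m = 0 then 2 * pi else 0)"
proof -
  let ?e = "\<lambda>x. exp (\<i> * complex_of_real (of_int m * x))"
  have "has_bochner_integral lborel (\<lambda>x. indicator {-pi..pi} x *\<^sub>R ?e x) (if m = 0 then 2 * pi else 0)"
  proof (cases "m = 0")
    case True
    then show ?thesis
      by (simp add: has_bochner_integral_iff emeasure_lborel_Icc_eq integrable_indicator_iff scaleR_conv_of_real)
  next
    case False
    define F where "F x = ?e x / (\<i> * of_int m)" for x :: real
    have per: "?e pi = ?e (- pi)"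
      unfolding exp_eq by (rule exI[of _ m]) (simp add: algebra_simps)
    have "has_bochner_integral lborel (\<lambda>x. indicator {-pi..pi} x *\<^sub>R ?e x) (F pi - F (- pi))"
    proof (rule has_bochner_integral_FTC_Icc)
      fix x :: real
      have "((\<lambda>z. exp (\<i> * (of_int m * z)) / (\<i> * of_int m)) has_field_derivative ?e x) (at (of_real x))"
        using False by (auto intro!: derivative_eq_intros simp: mult_ac)
      then have "((\<lambda>z. exp (\<i> * (of_int m * z)) / (\<i> * of_int m)) has_field_derivative ?e x) (at (of_real x) within A)" for A
        by (rule has_field_derivative_at_within)
      then show "(F has_vector_derivative ?e x) (at x within {- pi..pi})"
        unfolding F_def using has_vector_derivative_real_field by fastforce
    qed (auto intro!: continuous_intros)
    then show ?thesis using False per by (simp add: F_def)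
  qed
  moreover have "AE x in lborel. indicator {-pi..<pi} x *\<^sub>R ?e x = indicator {-pi..pi} x *\<^sub>R ?e x"
    by (rule AE_mp[OF AE_lborel_singleton[of pi]]) (auto simp: indicator_def)
  ultimately show ?thesis
    by (subst has_bochner_integral_cong_AE) simp_all
qed

lemma torus_indicator: "indicator torus t = (\<Prod>i\<in>UNIV. indicator {-pi..<pi} (t $ i) :: real)"
  by (auto simp: indicator_def torus_def prod_zero_iff split: if_splits)

lemma torus_borel [measurable]: "torus \<in> sets borel"
proof -
  have "torus = (\<Inter>i. {t::real^'d. t $ i \<in> {-pi..<pi}})" by (auto simp: torus_def)
  also have "\<dots> \<in> sets borel" by measurable
  finally show ?thesis .
qed

text \<open>The character factors over the coordinates, and for k \<noteq> l some coordinate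
  contributes a vanishing integral.\<close>

lemma orthogonality:
  fixes k l :: "nat^'d"
  shows "has_bochner_integral lborel
    (\<lambda>t. indicator torus t *\<^sub>R exp (\<i> * complex_of_real (freq_dot k t - freq_dot l t)))
    (if k = l then (2 * pi) ^ CARD('d) else 0)"
proof -
  \<comment> \<open>The difference is formed in \<open>int\<close>, since subtraction on
    \<open>nat\<close> would truncate.\<close>
  define m where "m i = int (k $ i) - int (l $ i)" for i
  define f where "f i x = indicator {-pi..<pi} x *\<^sub>R exp (\<i> * complex_of_real (of_int (m i) * x))" for i and x :: real
  have f: "integrable lborel (f i)" "integral\<^sup>L lborel (f i) = (if m i = 0 then 2 * pi else 0)" for i
    using has_bochner_integral_cis_period[of "m i"] unfolding f_def has_bochner_integral_iff by auto
  have eq: "indicator torus t *\<^sub>R exp (\<i> * complex_of_real (freq_dot k t - freq_dot l t)) = (\<Prod>i\<in>UNIV. f i (t $ i))" for t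
  proof -
    have "freq_dot k t - freq_dot l t = (\<Sum>i\<in>UNIV. of_int (m i) * t $ i)"
      by (simp add: freq_dot_def m_def sum_subtractf algebra_simps)
    then have "exp (\<i> * complex_of_real (freq_dot k t - freq_dot l t)) = (\<Prod>i\<in>UNIV. exp (\<i> * complex_of_real (of_int (m i) * t $ i)))"
      by (simp add: sum_distrib_left exp_sum)
    then show ?thesis
      by (simp add: torus_indicator f_def scaleR_conv_of_real prod.distrib)
  qed
  have "(\<Prod>i\<in>UNIV. integral\<^sup>L lborel (f i)) = (if k = l then (2 * pi) ^ CARD('d) else 0)"
    unfolding f by (auto simp: m_def vec_eq_iff intro!: prod_zero)
  then show ?thesis
    unfolding eq has_bochner_integral_iff using integrable_prod_vec[of f, OF f(1)] integral_prod_vec[of f, OF f(1)] by simp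
qed

text \<open>By orthogonality only the diagonal survives. The coefficients form an arbitrary matrix
  so that mixed moments E(Z_k Z_l) can be inserted: the expectation is taken first and the torus
  integral then removes all correlations.\<close>

lemma parseval_torus:
  fixes K :: "(nat^'d) set" and c :: "nat^'d \<Rightarrow> nat^'d \<Rightarrow> real"
  assumes "finite K"
  shows "has_bochner_integral lborel
    (\<lambda>t. indicator torus t *\<^sub>R (\<Sum>k\<in>K. \<Sum>l\<in>K. exp (\<i> * complex_of_real (freq_dot k t - freq_dot l t)) * complex_of_real (c k l)))
    (complex_of_real ((2 * pi) ^ CARD('d) * (\<Sum>k\<in>K. c k k)))"
proof -
  have "has_bochner_integral lborel
    (\<lambda>t. \<Sum>k\<in>K. \<Sum>l\<in>K. (indicator torus t *\<^sub>R exp (\<i> * complex_of_real (freq_dot k t - freq_dot l t))) * complex_of_real (c k l))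
    (\<Sum>k\<in>K. \<Sum>l\<in>K. complex_of_real (if k = l then (2 * pi) ^ CARD('d) else 0) * complex_of_real (c k l))"
    by (intro has_bochner_integral_sum has_bochner_integral_mult_left orthogonality)
  also have "(\<Sum>k\<in>K. \<Sum>l\<in>K. complex_of_real (if k = l then (2 * pi) ^ CARD('d) else 0) * complex_of_real (c k l))
      = complex_of_real ((2 * pi) ^ CARD('d) * (\<Sum>k\<in>K. c k k))"
  proof -
    have "(\<Sum>l\<in>K. complex_of_real (if k = l then (2 * pi) ^ CARD('d) else 0) * complex_of_real (c k l))
        = complex_of_real ((2 * pi) ^ CARD('d) * c k k)" if "k \<in> K" for k
    proof -
      have "(\<Sum>l\<in>K. complex_of_real (if k = l then (2 * pi) ^ CARD('d) else 0) * complex_of_real (c k l))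
        = (\<Sum>l\<in>K. if k = l then complex_of_real ((2 * pi) ^ CARD('d) * c k l) else 0)"
        by (intro sum.cong) auto
      then show ?thesis using that assms by simp
    qed
    then show ?thesis by (simp add: sum_distrib_left)
  qed
  finally show ?thesis
    by (simp add: scaleR_conv_of_real sum_distrib_left mult.assoc)
qed

section \<open>The tail bound for a single trigonometric sum\<close>

text \<open>Truncation, a union bound and Chebyshev's inequality. The bound is a majorant
  \<open>h\<close> whose measurability in t can be read off from its finite expansion into
  exponentials.\<close>

lemma (in prob_space) prob_trig_sum_bound:
  fixes Y :: "nat^'d \<Rightarrow> 'a \<Rightarrow> real" and K :: "(nat^'d) set"
  assumes K: "finite K" and [measurable]: "\<And>k. k \<in> K \<Longrightarrow> Y k \<in> borel_measurable M"
    and a: "a > 0" and \<epsilon>: "\<epsilon> > 0"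
  obtains h :: "real^'d \<Rightarrow> real" where "h \<in> borel_measurable borel"
    "\<And>t. \<P>(\<omega> in M. norm (\<Sum>k\<in>K. exp (\<i> * complex_of_real (freq_dot k t)) * complex_of_real (Y k \<omega>)) > \<epsilon> * a) \<le> h t"
    "(\<integral>\<^sup>+ t. ennreal (h t) * indicator torus t \<partial>lborel) \<le>
      ennreal ((2 * pi) ^ CARD('d) * (1 + 1 / \<epsilon>\<^sup>2) / a\<^sup>2) * (\<Sum>k\<in>K. \<integral>\<^sup>+ \<omega>. ennreal (min ((Y k \<omega>)\<^sup>2) (a\<^sup>2)) \<partial>M)"
proof -
  \<comment> \<open>Large values are set to 0, so Z agrees with Y wherever |Y| <= a and its square
    is at most min(Y^2, a^2).\<close>
  define Z where "Z k \<omega> = (if \<bar>Y k \<omega>\<bar> \<le> a then Y k \<omega> else 0)" for k \<omega>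
  define q where "q k = \<P>(\<omega> in M. \<bar>Y k \<omega>\<bar> > a)" for k
  define m where "m k = expectation (\<lambda>\<omega>. min ((Y k \<omega>)\<^sup>2) (a\<^sup>2))" for k
  define S where "S t \<omega> = (\<Sum>k\<in>K. exp (\<i> * complex_of_real (freq_dot k t)) * complex_of_real (Z k \<omega>))" for t \<omega>
  define g where "g t = expectation (\<lambda>\<omega>. (cmod (S t \<omega>))\<^sup>2)" for t
  have Z[measurable]: "Z k \<in> borel_measurable M" if "k \<in> K" for k
    using that unfolding Z_def by measurable
  have Z_le: "\<bar>Z k \<omega>\<bar> \<le> a" for k \<omega> using a by (simp add: Z_def)
  have S_expand: "complex_of_real ((cmod (S t \<omega>))\<^sup>2) =
      (\<Sum>k\<in>K. \<Sum>l\<in>K. exp (\<i> * complex_of_real (freq_dot k t - freq_dot l t)) * complex_of_real (Z k \<omega> * Z l \<omega>))" for t \<omega>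
  proof -
    have "complex_of_real ((cmod (S t \<omega>))\<^sup>2) = S t \<omega> * cnj (S t \<omega>)" by (rule complex_norm_square)
    also have "cnj (S t \<omega>) = (\<Sum>l\<in>K. exp (- \<i> * complex_of_real (freq_dot l t)) * complex_of_real (Z l \<omega>))"
      by (simp add: S_def exp_cnj)
    also have "S t \<omega> * \<dots> = (\<Sum>k\<in>K. \<Sum>l\<in>K. exp (\<i> * complex_of_real (freq_dot k t)) * complex_of_real (Z k \<omega>) *
        (exp (- \<i> * complex_of_real (freq_dot l t)) * complex_of_real (Z l \<omega>)))"
      unfolding S_def by (rule sum_product)
    also have "\<dots> = (\<Sum>k\<in>K. \<Sum>l\<in>K. exp (\<i> * complex_of_real (freq_dot k t - freq_dot l t)) * complex_of_real (Z k \<omega> * Z l \<omega>))"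
      by (intro sum.cong refl) (simp add: exp_diff exp_minus right_diff_distrib divide_inverse mult_ac)
    finally show ?thesis .
  qed
  have ZZ: "integrable M (\<lambda>\<omega>. Z k \<omega> * Z l \<omega>)" if "k \<in> K" "l \<in> K" for k l
    using that a by (intro integrable_const_bound[where B="a * a"]) (auto simp: abs_mult intro!: mult_mono Z_le)
  have ZZ_exp: "integrable M (\<lambda>\<omega>. exp (\<i> * complex_of_real (freq_dot k t - freq_dot l t)) * complex_of_real (Z k \<omega> * Z l \<omega>))"
    if "k \<in> K" "l \<in> K" for k l t
    by (intro integrable_mult_right integrable_of_real ZZ that)
  have S_int: "integrable M (\<lambda>\<omega>. (cmod (S t \<omega>))\<^sup>2)" for t
  proof (rule integrable_const_bound[where B="(\<Sum>k\<in>K. a)\<^sup>2"])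
    have "cmod (S t \<omega>) \<le> (\<Sum>k\<in>K. a)" for \<omega>
      unfolding S_def by (intro order_trans[OF norm_sum] sum_mono) (simp add: norm_mult Z_le)
    then show "AE \<omega> in M. norm ((cmod (S t \<omega>))\<^sup>2) \<le> (\<Sum>k\<in>K. a)\<^sup>2"
      by (intro AE_I2) (auto intro!: power_mono)
    show "(\<lambda>\<omega>. (cmod (S t \<omega>))\<^sup>2) \<in> borel_measurable M" unfolding S_def by measurable
  qed
  have g_expand: "complex_of_real (g t) =
      (\<Sum>k\<in>K. \<Sum>l\<in>K. exp (\<i> * complex_of_real (freq_dot k t - freq_dot l t)) * complex_of_real (expectation (\<lambda>\<omega>. Z k \<omega> * Z l \<omega>)))" for t
  proof -
    have "complex_of_real (g t) = (LINT \<omega>|M. complex_of_real ((cmod (S t \<omega>))\<^sup>2))"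
      unfolding g_def by (rule integral_complex_of_real[symmetric])
    also have "\<dots> = (\<Sum>k\<in>K. \<Sum>l\<in>K. LINT \<omega>|M. exp (\<i> * complex_of_real (freq_dot k t - freq_dot l t)) * complex_of_real (Z k \<omega> * Z l \<omega>))"
      unfolding S_expand by (simp only: Bochner_Integration.integral_sum Bochner_Integration.integrable_sum ZZ_exp cong: sum.cong)
    also have "\<dots> = (\<Sum>k\<in>K. \<Sum>l\<in>K. exp (\<i> * complex_of_real (freq_dot k t - freq_dot l t)) * complex_of_real (expectation (\<lambda>\<omega>. Z k \<omega> * Z l \<omega>)))"
      by (intro sum.cong refl) (simp only: integral_mult_right_zero integral_complex_of_real)
    finally show ?thesis .
  qed
  have g_nonneg: "g t \<ge> 0" for t by (simp add: g_def)
  have g_measurable[measurable]: "g \<in> borel_measurable borel"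
  proof -
    have "continuous_on UNIV (freq_dot k)" for k :: "nat^'d"
      unfolding freq_dot_def[abs_def] by (intro continuous_intros)
    then have [measurable]: "freq_dot k \<in> borel_measurable borel" for k :: "nat^'d"
      by (rule borel_measurable_continuous_onI)
    \<comment> \<open>In the expansion t enters only through finitely many continuous
      exponentials.\<close>
    have "g = (\<lambda>t. Re (complex_of_real (g t)))" by simp
    also have "\<dots> \<in> borel_measurable borel" unfolding g_expand by measurable
    finally show ?thesis .
  qed
  have g_int: "has_bochner_integral lborel (\<lambda>t. g t * indicator torus t)
      ((2 * pi) ^ CARD('d) * (\<Sum>k\<in>K. expectation (\<lambda>\<omega>. (Z k \<omega>)\<^sup>2)))"
  proof -
    have "has_bochner_integral lborel (\<lambda>t. indicator torus t *\<^sub>R complex_of_real (g t))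
        (complex_of_real ((2 * pi) ^ CARD('d) * (\<Sum>k\<in>K. expectation (\<lambda>\<omega>. Z k \<omega> * Z k \<omega>))))"
      unfolding g_expand by (rule parseval_torus[OF K])
    from has_bochner_integral_bounded_linear[OF bounded_linear_Re this] show ?thesis
      by (simp add: power2_eq_square mult_ac)
  qed
  have torus_int: "(\<integral>\<^sup>+ t. indicator (torus :: (real^'d) set) t \<partial>lborel) = ennreal ((2 * pi) ^ CARD('d))"
  proof -
    \<comment> \<open>The volume of the torus is the case k = l = 0 of orthogonality.\<close>
    have "has_bochner_integral lborel (indicator (torus :: (real^'d) set)) ((2 * pi) ^ CARD('d) :: real)"
      using has_bochner_integral_bounded_linear[OF bounded_linear_Re orthogonality[of "0 :: nat^'d" 0]] by simp
    then have "(\<integral>\<^sup>+ t. ennreal (indicator (torus :: (real^'d) set) t) \<partial>lborel) = ennreal ((2 * pi) ^ CARD('d))"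
      by (subst nn_integral_eq_integral) (auto simp: has_bochner_integral_iff)
    then show ?thesis by (simp add: ennreal_indicator)
  qed
  have trunc_int: "integrable M (\<lambda>\<omega>. min ((Y k \<omega>)\<^sup>2) (a\<^sup>2))" if "k \<in> K" for k
    using that by (intro integrable_const_bound[where B="a\<^sup>2"]) auto
  have Z_m: "expectation (\<lambda>\<omega>. (Z k \<omega>)\<^sup>2) \<le> m k" if "k \<in> K" for k
    unfolding m_def
  proof (intro integral_mono trunc_int that)
    show "integrable M (\<lambda>\<omega>. (Z k \<omega>)\<^sup>2)" using ZZ[OF that that] by (simp add: power2_eq_square)
    show "(Z k \<omega>)\<^sup>2 \<le> min ((Y k \<omega>)\<^sup>2) (a\<^sup>2)" for \<omega>
      using a by (auto simp: Z_def abs_le_square_iff[symmetric])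
  qed
  have q_m: "q k \<le> m k / a\<^sup>2" if "k \<in> K" for k
  proof -
    \<comment> \<open>Where |Y k| > a the truncated square equals a^2, so Markov's inequality bounds
      the tail by the same moment that bounds the second moment of Z.\<close>
    have "q k \<le> \<P>(\<omega> in M. min ((Y k \<omega>)\<^sup>2) (a\<^sup>2) \<ge> a\<^sup>2)"
      unfolding q_def using that a
      by (intro finite_measure_mono) (auto simp: abs_le_square_iff[symmetric])
    also have "\<dots> \<le> m k / a\<^sup>2"
      unfolding m_def using a
      by (intro integral_Markov_inequality_measure[where A="{}"] trunc_int that) auto
    finally show ?thesis .
  qed
  \<comment> \<open>The first term bounds the probability that truncation changes some variable; the
    second is Chebyshev's bound for the truncated sum.\<close>
  define h where "h t = (\<Sum>k\<in>K. q k) + g t / (\<epsilon> * a)\<^sup>2" for t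
  show thesis
  proof (rule that[of h])
    show "h \<in> borel_measurable borel" unfolding h_def by measurable
    show "\<P>(\<omega> in M. norm (\<Sum>k\<in>K. exp (\<i> * complex_of_real (freq_dot k t)) * complex_of_real (Y k \<omega>)) > \<epsilon> * a) \<le> h t" for t
    proof -
      let ?T = "\<lambda>\<omega>. \<Sum>k\<in>K. exp (\<i> * complex_of_real (freq_dot k t)) * complex_of_real (Y k \<omega>)"
      let ?A = "\<Union>k\<in>K. {\<omega>\<in>space M. \<bar>Y k \<omega>\<bar> > a}" and ?B = "{\<omega>\<in>space M. (cmod (S t \<omega>))\<^sup>2 \<ge> (\<epsilon> * a)\<^sup>2}"
      have [measurable]: "S t \<in> borel_measurable M" unfolding S_def by measurable
      have A: "?A \<in> sets M" using K by (intro sets.finite_UN) auto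
      have B: "?B \<in> sets M" by measurable
      have "{\<omega>\<in>space M. norm (?T \<omega>) > \<epsilon> * a} \<subseteq> ?A \<union> ?B"
      proof
        fix \<omega> assume \<omega>: "\<omega> \<in> {\<omega>\<in>space M. norm (?T \<omega>) > \<epsilon> * a}"
        show "\<omega> \<in> ?A \<union> ?B"
        proof (cases "\<omega> \<in> ?A")
          case False
          then have "Z k \<omega> = Y k \<omega>" if "k \<in> K" for k using that \<omega> by (auto simp: Z_def)
          then have "S t \<omega> = ?T \<omega>" unfolding S_def by (intro sum.cong) auto
          then have "(\<epsilon> * a)\<^sup>2 \<le> (cmod (S t \<omega>))\<^sup>2" using \<omega> a \<epsilon> by (intro power_mono) auto
          then show ?thesis using \<omega> by auto
        qed simp
      qed
      then have "\<P>(\<omega> in M. norm (?T \<omega>) > \<epsilon> * a) \<le> measure M (?A \<union> ?B)"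
        using A B by (intro finite_measure_mono) auto
      also have "\<dots> \<le> measure M ?A + measure M ?B" by (rule measure_Un_le[OF A B])
      also have "measure M ?A \<le> (\<Sum>k\<in>K. q k)"
        unfolding q_def using K by (intro measure_UNION_le) auto
      also have "measure M ?B \<le> g t / (\<epsilon> * a)\<^sup>2"
        unfolding g_def using a \<epsilon>
        by (intro integral_Markov_inequality_measure[where A="{}"] S_int) auto
      finally show ?thesis by (simp add: h_def)
    qed
    have q_nonneg: "(\<Sum>k\<in>K. q k) \<ge> 0" by (intro sum_nonneg) (simp add: q_def)
    have Q: "(\<Sum>k\<in>K. expectation (\<lambda>\<omega>. (Z k \<omega>)\<^sup>2)) \<ge> 0" by (intro sum_nonneg) simp
    have "(\<integral>\<^sup>+ t. ennreal (h t) * indicator torus t \<partial>lborel) =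
        (\<integral>\<^sup>+ t. ennreal (\<Sum>k\<in>K. q k) * indicator torus t + ennreal (1 / (\<epsilon> * a)\<^sup>2) * ennreal (g t * indicator torus t) \<partial>lborel)"
      using q_nonneg g_nonneg
      by (intro nn_integral_cong)
         (auto simp: h_def ennreal_plus[symmetric] ennreal_mult[symmetric] split: split_indicator simp del: ennreal_plus)
    also have "\<dots> = ennreal (\<Sum>k\<in>K. q k) * ennreal ((2 * pi) ^ CARD('d)) +
        ennreal (1 / (\<epsilon> * a)\<^sup>2) * ennreal ((2 * pi) ^ CARD('d) * (\<Sum>k\<in>K. expectation (\<lambda>\<omega>. (Z k \<omega>)\<^sup>2)))"
    proof -
      have "(\<integral>\<^sup>+ t. ennreal (g t * indicator torus t) \<partial>lborel) = ennreal ((2 * pi) ^ CARD('d) * (\<Sum>k\<in>K. expectation (\<lambda>\<omega>. (Z k \<omega>)\<^sup>2)))"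
        using g_int g_nonneg by (subst nn_integral_eq_integral) (auto simp: has_bochner_integral_iff)
      then show ?thesis
        by (subst nn_integral_add) (auto simp: nn_integral_cmult torus_int)
    qed
    also have "\<dots> = ennreal ((2 * pi) ^ CARD('d) * ((\<Sum>k\<in>K. q k) + (\<Sum>k\<in>K. expectation (\<lambda>\<omega>. (Z k \<omega>)\<^sup>2)) / (\<epsilon> * a)\<^sup>2))"
      using q_nonneg Q by (simp add: ennreal_plus[symmetric] ennreal_mult[symmetric] algebra_simps del: ennreal_plus)
    also have "\<dots> \<le> ennreal ((2 * pi) ^ CARD('d) * (1 + 1 / \<epsilon>\<^sup>2) / a\<^sup>2 * (\<Sum>k\<in>K. m k))"
    proof (intro ennreal_leI)
      \<comment> \<open>In the constant 1 + 1/\<epsilon>^2 the 1 comes from the large values and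
        1/\<epsilon>^2 from Chebyshev's inequality.\<close>
      have "(\<Sum>k\<in>K. q k) + (\<Sum>k\<in>K. expectation (\<lambda>\<omega>. (Z k \<omega>)\<^sup>2)) / (\<epsilon> * a)\<^sup>2 \<le> (\<Sum>k\<in>K. m k / a\<^sup>2) + (\<Sum>k\<in>K. m k) / (\<epsilon> * a)\<^sup>2"
        by (intro add_mono divide_right_mono sum_mono q_m Z_m) auto
      also have "\<dots> = (1 + 1 / \<epsilon>\<^sup>2) / a\<^sup>2 * (\<Sum>k\<in>K. m k)"
        using a \<epsilon> by (simp add: sum_divide_distrib[symmetric] field_simps)
      finally have "(2 * pi) ^ CARD('d) * ((\<Sum>k\<in>K. q k) + (\<Sum>k\<in>K. expectation (\<lambda>\<omega>. (Z k \<omega>)\<^sup>2)) / (\<epsilon> * a)\<^sup>2)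
          \<le> (2 * pi) ^ CARD('d) * ((1 + 1 / \<epsilon>\<^sup>2) / a\<^sup>2 * (\<Sum>k\<in>K. m k))"
        by (intro mult_left_mono) auto
      then show "(2 * pi) ^ CARD('d) * ((\<Sum>k\<in>K. q k) + (\<Sum>k\<in>K. expectation (\<lambda>\<omega>. (Z k \<omega>)\<^sup>2)) / (\<epsilon> * a)\<^sup>2)
          \<le> (2 * pi) ^ CARD('d) * (1 + 1 / \<epsilon>\<^sup>2) / a\<^sup>2 * (\<Sum>k\<in>K. m k)"
        by (simp add: mult.assoc)
    qed
    also have "\<dots> = ennreal ((2 * pi) ^ CARD('d) * (1 + 1 / \<epsilon>\<^sup>2) / a\<^sup>2) * (\<Sum>k\<in>K. \<integral>\<^sup>+ \<omega>. ennreal (min ((Y k \<omega>)\<^sup>2) (a\<^sup>2)) \<partial>M)"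
    proof -
      have m_nonneg: "m k \<ge> 0" for k by (simp add: m_def)
      have "(\<Sum>k\<in>K. \<integral>\<^sup>+ \<omega>. ennreal (min ((Y k \<omega>)\<^sup>2) (a\<^sup>2)) \<partial>M) = (\<Sum>k\<in>K. ennreal (m k))"
        unfolding m_def by (intro sum.cong refl nn_integral_eq_integral trunc_int) auto
      also have "\<dots> = ennreal (\<Sum>k\<in>K. m k)" using m_nonneg by (intro sum_ennreal) auto
      finally have eq: "(\<Sum>k\<in>K. \<integral>\<^sup>+ \<omega>. ennreal (min ((Y k \<omega>)\<^sup>2) (a\<^sup>2)) \<partial>M) = ennreal (\<Sum>k\<in>K. m k)" .
      show ?thesis
        unfolding eq by (rule ennreal_mult) (auto intro!: sum_nonneg m_nonneg)
    qed
    finally show "(\<integral>\<^sup>+ t. ennreal (h t) * indicator torus t \<partial>lborel) \<le>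
      ennreal ((2 * pi) ^ CARD('d) * (1 + 1 / \<epsilon>\<^sup>2) / a\<^sup>2) * (\<Sum>k\<in>K. \<integral>\<^sup>+ \<omega>. ennreal (min ((Y k \<omega>)\<^sup>2) (a\<^sup>2)) \<partial>M)" .
  qed
qed

subsection \<open>Convergence of the series\<close>

text \<open>Countability makes the counting measure sigma-finite and lets joint measurability be
  checked one index at a time.\<close>

lemma borel_measurable_nn_integral_count_space:
  assumes "countable A" "\<And>i. i \<in> A \<Longrightarrow> f i \<in> borel_measurable N"
  shows "(\<lambda>t. \<integral>\<^sup>+ i. f i t \<partial>count_space A) \<in> borel_measurable N"
proof -
  interpret sigma_finite_measure "count_space A"
    using assms(1) by (rule sigma_finite_measure_count_space_countable)
  have "(\<lambda>(i, t). f i t) \<in> borel_measurable (count_space A \<Otimes>\<^sub>M N)"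
    using assms by (intro measurable_pair_measure_countable1) auto
  then have "(\<lambda>(t, i). f i t) \<in> borel_measurable (N \<Otimes>\<^sub>M count_space A)"
    by (subst measurable_pair_swap_iff) (simp add: case_prod_unfold)
  then show ?thesis by (rule borel_measurable_nn_integral)
qed

text \<open>Integrability against the counting measure is absolute summability.\<close>

lemma summable_on_if_nn_integral_count_space_finite:
  fixes f :: "'i \<Rightarrow> real"
  assumes "(\<integral>\<^sup>+ i. ennreal (norm (f i)) \<partial>count_space A) < \<infinity>"
  shows "f summable_on A"
proof -
  have "integrable (count_space A) f"
    using assms by (intro integrableI_bounded) auto
  then have "Infinite_Set_Sum.abs_summable_on f A" by (simp add: abs_summable_on_def)
  then show ?thesis unfolding abs_summable_equivalent[symmetric] by (rule abs_summable_summable)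
qed

theorem theorem3p2:
  fixes P :: "'a measure"
    and X :: "'a \<Rightarrow> real"
    and Y :: "nat^'d \<Rightarrow> 'a \<Rightarrow> real"
    and M p r :: real
  assumes "prob_space P"
    and "X \<in> borel_measurable P"
    and "\<And>n. n \<in> pos_lattice \<Longrightarrow> Y n \<in> borel_measurable P"
    and "M > 0"
    and "\<And>x n. x \<ge> 0 \<Longrightarrow> n \<in> pos_lattice \<Longrightarrow>
           1 / lattice_vol n * (\<Sum>k\<in>lattice_box n. \<P>(\<omega> in P. \<bar>Y k \<omega>\<bar> > x))
             \<le> M * \<P>(\<omega> in P. \<bar>X \<omega>\<bar> > x)"
    and "1 < p" "p < 2" "1 \<le> r" "r \<le> p"
    and "integrable P (\<lambda>\<omega>. \<bar>X \<omega>\<bar> powr p * log_plus \<bar>X \<omega>\<bar> ^ (CARD('d) - 1))"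
  shows "\<forall>\<epsilon>>0. AE t in lebesgue_on (torus :: (real^'d) set).
           (\<lambda>n. lattice_vol n powr (p / r - 2) *
                 \<P>(\<omega> in P. norm (dft Y n t \<omega>) > \<epsilon> * lattice_vol n powr (1 / r)))
             summable_on pos_lattice"
proof (intro allI impI)
  fix \<epsilon> :: real assume \<epsilon>: "\<epsilon> > 0"
  interpret prob_space P by fact
  note [measurable] = assms(2,3)
  let ?L = "pos_lattice :: (nat^'d) set"
  define D where "D = CARD('d) - 1"
  define B where "B = (2 * pi) ^ CARD('d) * (1 + 1 / \<epsilon>\<^sup>2)"
  have B: "B \<ge> 0" by (simp add: B_def)
  define a where "a n = lattice_vol n powr (1 / r)" for n :: "nat^'d"
  define E where "E n = (\<integral>\<^sup>+ \<omega>. ennreal (min ((X \<omega>)\<^sup>2) ((a n)\<^sup>2)) \<partial>P)" for n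
  have vol: "lattice_vol n \<ge> 1" if "n \<in> ?L" for n using that by (rule lattice_vol_ge_1)
  \<comment> \<open>The three properties are bundled so that one choice yields majorants for all
    lattice points at once.\<close>
  define good where "good n h \<longleftrightarrow> h \<in> borel_measurable borel \<and>
      (\<forall>t. \<P>(\<omega> in P. norm (dft Y n t \<omega>) > \<epsilon> * a n) \<le> h t) \<and>
      (\<integral>\<^sup>+ t. ennreal (h t) * indicator torus t \<partial>lborel) \<le> ennreal (B / (a n)\<^sup>2) * (ennreal (M * lattice_vol n) * E n)"
    for n and h :: "real^'d \<Rightarrow> real"
  have "\<exists>h. good n h"
    if n: "n \<in> ?L" for n
  proof -
    have a: "a n > 0" using vol[OF n] by (simp add: a_def)
    have Y: "Y k \<in> borel_measurable P" if "k \<in> lattice_box n" for k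
      using that assms(3) by (simp add: lattice_box_def)
    obtain h :: "real^'d \<Rightarrow> real" where h: "h \<in> borel_measurable borel"
      "\<And>t. \<P>(\<omega> in P. norm (\<Sum>k\<in>lattice_box n. exp (\<i> * complex_of_real (freq_dot k t)) * complex_of_real (Y k \<omega>)) > \<epsilon> * a n) \<le> h t"
      "(\<integral>\<^sup>+ t. ennreal (h t) * indicator torus t \<partial>lborel) \<le>
        ennreal (B / (a n)\<^sup>2) * (\<Sum>k\<in>lattice_box n. \<integral>\<^sup>+ \<omega>. ennreal (min ((Y k \<omega>)\<^sup>2) ((a n)\<^sup>2)) \<partial>P)"
      using prob_trig_sum_bound[OF finite_lattice_box[of n], where Y=Y, OF Y a \<epsilon>] unfolding B_def by blast
    have "(\<Sum>k\<in>lattice_box n. \<integral>\<^sup>+ \<omega>. ennreal (min ((Y k \<omega>)\<^sup>2) ((a n)\<^sup>2)) \<partial>P) \<le> ennreal (M * lattice_vol n) * E n"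
      unfolding E_def
    proof (rule sum_truncated_square_le)
      fix x :: real assume "x \<ge> 0"
      then show "(\<Sum>k\<in>lattice_box n. \<P>(\<omega> in P. \<bar>Y k \<omega>\<bar> > x)) \<le> M * lattice_vol n * \<P>(\<omega> in P. \<bar>X \<omega>\<bar> > x)"
        using assms(5)[of x n] n vol[OF n] by (simp add: field_simps)
    qed (use assms(2,4) Y a vol[OF n] in auto)
    then have "(\<integral>\<^sup>+ t. ennreal (h t) * indicator torus t \<partial>lborel) \<le> ennreal (B / (a n)\<^sup>2) * (ennreal (M * lattice_vol n) * E n)"
      by (intro order_trans[OF h(3)] mult_left_mono) auto
    then show ?thesis using h(1,2) unfolding good_def dft_def by blast
  qed
  then obtain h where h: "\<And>n. n \<in> ?L \<Longrightarrow> good n (h n)" by metis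
  have h_meas: "h n \<in> borel_measurable borel"
    and h_bound: "\<P>(\<omega> in P. norm (dft Y n t \<omega>) > \<epsilon> * a n) \<le> h n t"
    and h_int: "(\<integral>\<^sup>+ t. ennreal (h n t) * indicator torus t \<partial>lborel) \<le> ennreal (B / (a n)\<^sup>2) * (ennreal (M * lattice_vol n) * E n)"
    if "n \<in> ?L" for n t
    using h[OF that] unfolding good_def by blast+
  obtain C where C: "C \<ge> 0" "\<And>x. (\<integral>\<^sup>+ n. ennreal (lattice_vol n powr (p / r - 1 - 2 / r) * min (x\<^sup>2) ((a n)\<^sup>2)) \<partial>count_space ?L)
      \<le> ennreal (C * (\<bar>x\<bar> powr p * log_plus \<bar>x\<bar> ^ D))"
    using lattice_kernel_bound[OF assms(6-9), where 'd='d] unfolding a_def D_def by blast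
  \<comment> \<open>The weighted majorant of the n-th term, cut off to the torus; showing that its
    sum over n has a finite integral is the aim.\<close>
  define H where "H n t = ennreal (lattice_vol n powr (p / r - 2)) * (ennreal (h n t) * indicator torus t)" for n t
  have H_meas[measurable]: "H n \<in> borel_measurable borel" if "n \<in> ?L" for n
    using h_meas[OF that] unfolding H_def by measurable
  have "(\<integral>\<^sup>+ t. \<integral>\<^sup>+ n. H n t \<partial>count_space ?L \<partial>lborel) = (\<integral>\<^sup>+ n. \<integral>\<^sup>+ t. H n t \<partial>lborel \<partial>count_space ?L)"
    by (intro nn_integral_count_space_nn_integral countable_pos_lattice) simp
  also have "\<dots> \<le> (\<integral>\<^sup>+ n. ennreal (B * M) * (\<integral>\<^sup>+ \<omega>. ennreal (lattice_vol n powr (p / r - 1 - 2 / r) * min ((X \<omega>)\<^sup>2) ((a n)\<^sup>2)) \<partial>P) \<partial>count_space ?L)"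
  proof (intro nn_integral_mono)
    fix n assume "n \<in> space (count_space ?L)"
    then have n: "n \<in> ?L" by simp
    define v where "v = lattice_vol n"
    have v: "v \<ge> 1" using vol[OF n] by (simp add: v_def)
    have "(\<integral>\<^sup>+ t. H n t \<partial>lborel) = ennreal (v powr (p / r - 2)) * (\<integral>\<^sup>+ t. ennreal (h n t) * indicator torus t \<partial>lborel)"
      unfolding H_def v_def using h_meas[OF n] by (intro nn_integral_cmult) simp
    also have "\<dots> \<le> ennreal (v powr (p / r - 2)) * (ennreal (B / (a n)\<^sup>2) * (ennreal (M * v) * E n))"
      unfolding v_def by (intro mult_left_mono h_int n) auto
    also have "\<dots> = ennreal (v powr (p / r - 2) * (B / (a n)\<^sup>2) * (M * v)) * E n"
    proof -
      have "ennreal x * (ennreal y * (ennreal z * e)) = ennreal (x * y * z) * e"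
        if "0 \<le> x" "0 \<le> y" "0 \<le> z" for x y z e
        using that by (simp add: ennreal_mult mult.assoc)
      then show ?thesis using B assms(4) v by simp
    qed
    \<comment> \<open>The exponents add up: p/r - 2 from the weight, -2/r from dividing by a^2, and
      1 from the volume of the box.\<close>
    also have "v powr (p / r - 2) * (B / (a n)\<^sup>2) * (M * v) = B * M * v powr (p / r - 1 - 2 / r)"
    proof -
      have "v powr (p / r - 1 - 2 / r) = v powr ((p / r - 2) + - (2 / r) + 1)" by (simp add: algebra_simps)
      also have "\<dots> = v powr (p / r - 2) * v powr - (2 / r) * v powr 1" by (simp only: powr_add)
      also have "v powr - (2 / r) = 1 / (a n)\<^sup>2"
        using v by (simp add: a_def v_def[symmetric] powr_power powr_minus_divide)
      finally show ?thesis using v by simp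
    qed
    also have "ennreal (B * M * v powr (p / r - 1 - 2 / r)) * E n = ennreal (B * M) * (ennreal (v powr (p / r - 1 - 2 / r)) * E n)"
      using B assms(4) by (simp add: ennreal_mult mult.assoc)
    also have "ennreal (v powr (p / r - 1 - 2 / r)) * E n = (\<integral>\<^sup>+ \<omega>. ennreal (v powr (p / r - 1 - 2 / r) * min ((X \<omega>)\<^sup>2) ((a n)\<^sup>2)) \<partial>P)"
      unfolding E_def by (subst nn_integral_cmult[symmetric]) (auto simp: ennreal_mult)
    finally show "(\<integral>\<^sup>+ t. H n t \<partial>lborel) \<le> ennreal (B * M) * (\<integral>\<^sup>+ \<omega>. ennreal (lattice_vol n powr (p / r - 1 - 2 / r) * min ((X \<omega>)\<^sup>2) ((a n)\<^sup>2)) \<partial>P)"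
      by (simp add: v_def)
  qed
  also have "\<dots> = ennreal (B * M) * (\<integral>\<^sup>+ n. \<integral>\<^sup>+ \<omega>. ennreal (lattice_vol n powr (p / r - 1 - 2 / r) * min ((X \<omega>)\<^sup>2) ((a n)\<^sup>2)) \<partial>P \<partial>count_space ?L)"
    by (intro nn_integral_cmult) simp
  \<comment> \<open>With the sum innermost, the kernel bound applies pointwise in \<omega> at x =
    \<open>X \<omega>\<close>, and the moment hypothesis finishes the estimate.\<close>
  also have "(\<integral>\<^sup>+ n. \<integral>\<^sup>+ \<omega>. ennreal (lattice_vol n powr (p / r - 1 - 2 / r) * min ((X \<omega>)\<^sup>2) ((a n)\<^sup>2)) \<partial>P \<partial>count_space ?L)
      = (\<integral>\<^sup>+ \<omega>. \<integral>\<^sup>+ n. ennreal (lattice_vol n powr (p / r - 1 - 2 / r) * min ((X \<omega>)\<^sup>2) ((a n)\<^sup>2)) \<partial>count_space ?L \<partial>P)"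
    by (intro nn_integral_count_space_nn_integral[symmetric] countable_pos_lattice) measurable
  also have "ennreal (B * M) * \<dots> \<le> ennreal (B * M) * (\<integral>\<^sup>+ \<omega>. ennreal (C * (\<bar>X \<omega>\<bar> powr p * log_plus \<bar>X \<omega>\<bar> ^ D)) \<partial>P)"
    by (intro mult_left_mono nn_integral_mono C) auto
  also have "\<dots> < \<infinity>"
  proof -
    have "(\<integral>\<^sup>+ \<omega>. ennreal (C * (\<bar>X \<omega>\<bar> powr p * log_plus \<bar>X \<omega>\<bar> ^ D)) \<partial>P)
        = ennreal (expectation (\<lambda>\<omega>. C * (\<bar>X \<omega>\<bar> powr p * log_plus \<bar>X \<omega>\<bar> ^ D)))"
      using assms(10) C(1) by (intro nn_integral_eq_integral) (auto simp: D_def log_plus_def)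
    then show ?thesis by (simp add: ennreal_mult_less_top)
  qed
  finally have fin: "(\<integral>\<^sup>+ t. \<integral>\<^sup>+ n. H n t \<partial>count_space ?L \<partial>lborel) \<noteq> \<infinity>" by simp
  \<comment> \<open>A function with finite integral is finite almost everywhere. As \<epsilon> is
    fixed, the exceptional set may depend on it.\<close>
  have "AE t in lborel. (\<integral>\<^sup>+ n. H n t \<partial>count_space ?L) \<noteq> \<infinity>"
    by (rule nn_integral_noteq_infinite[OF _ fin])
       (intro borel_measurable_nn_integral_count_space countable_pos_lattice, simp)
  then have "AE t in lborel. t \<in> torus \<longrightarrow> (\<lambda>n. lattice_vol n powr (p / r - 2) *
      \<P>(\<omega> in P. norm (dft Y n t \<omega>) > \<epsilon> * lattice_vol n powr (1 / r))) summable_on ?L"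
  proof (eventually_elim, intro impI summable_on_if_nn_integral_count_space_finite)
    fix t :: "real^'d" assume t: "(\<integral>\<^sup>+ n. H n t \<partial>count_space ?L) \<noteq> \<infinity>" "t \<in> torus"
    have "(\<integral>\<^sup>+ n. ennreal (norm (lattice_vol n powr (p / r - 2) *
        \<P>(\<omega> in P. norm (dft Y n t \<omega>) > \<epsilon> * lattice_vol n powr (1 / r)))) \<partial>count_space ?L) \<le> (\<integral>\<^sup>+ n. H n t \<partial>count_space ?L)"
      using h_bound t(2)
      by (intro nn_integral_mono) (auto simp: H_def a_def ennreal_mult' intro!: mult_left_mono ennreal_leI)
    also have "\<dots> < \<infinity>" using t(1) by (simp add: less_top)
    finally show "(\<integral>\<^sup>+ n. ennreal (norm (lattice_vol n powr (p / r - 2) *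
        \<P>(\<omega> in P. norm (dft Y n t \<omega>) > \<epsilon> * lattice_vol n powr (1 / r)))) \<partial>count_space ?L) < \<infinity>" .
  qed
  \<comment> \<open>A null set of \<open>lborel\<close> remains null for the completed measure
    restricted to the torus.\<close>
  then show "AE t in lebesgue_on (torus :: (real^'d) set). (\<lambda>n. lattice_vol n powr (p / r - 2) *
      \<P>(\<omega> in P. norm (dft Y n t \<omega>) > \<epsilon> * lattice_vol n powr (1 / r))) summable_on ?L"
    by (subst AE_restrict_space_iff) (auto intro: AE_completion)
qed

end
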